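(* Consider any completed run of the batched delayed-rotation construction (described in the context) against a deterministic adaptive $T$-call algorithm, with queries $x_1,\dots,x_T$, responses $r_1,\dots,r_T$, terminal output $\widehat x$, and final frame $U=(u_1,\dots,u_m)$. Then every response equals the corresponding value of the single function $F_U$: $$r_t=F_U(x_t),\qquad t=1,\dots,T.$$ Consequently, the query sequence and terminal output generated by the construction are exactly the query sequence and output produced when the algorithm interacts with the fixed objective $F_U$.
   Context: Parameters: $R,\beta_0>0$, integers $d,m$ with $1\le m\le d/4$, $X:=B_2^d(R)$ (closed Euclidean ball of radius $R$ centred at $0$), $R_0:=R/4$, $\rho:=R_0/(64m^{3/2})$, $A:=\beta_0\rho/8$, $\eta:=\beta_0/(4096m^2)$. Put $g_{m,\rho}(y):=\max_{1\le i\le m}\{y_i-8\rho i\}$, $h_{m,\rho}(y):=\inf_{z\in\mathbb R^m}\{g_{m,\rho}(z)+\frac1\rho\|z-y\|_2^2\}$ for $y\in\mathbb R^m$, and $q_0(x):=\frac{\beta_0}{8}\operatorname{dist}(x,B_2^d(R_0))^2+\frac\eta2\|x\|_2^2$. A deterministic adaptive $T$-call algorithm consists of Borel maps giving each query $x_t\in X$ as a function of the previous query/response pairs $(x_1,r_1),\dots,(x_{t-1},r_{t-1})$, and a Borel map giving the output $\widehat x\in X$ as a function of all $T$ pairs; when it interacts with a fixed objective $f$, $r_t=f(x_t)$. Construction: let $b:=\lfloor d/4\rfloor$, $T=qb+s$ with $0\le s<b$, and assume $T<bm$ (so $0\le q\le m-1$). Unit vectors $u_1,\dots,u_m\in\mathbb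 R^d$ are chosen successively. For $j=1,\dots,q$ (complete block $j$, the queries $x_{(j-1)b+1},\dots,x_{jb}$): with $u_1,\dots,u_{j-1}$ already chosen, every query $x$ of the block is answered by $r(x)=A\,h_{m,\rho}(\langle u_1,x\rangle,\dots,\langle u_{j-1},x\rangle,0,\dots,0)+q_0(x)$; after the block is finished, a unit vector $u_j$ is chosen orthogonal to $u_1,\dots,u_{j-1}$ and to all $b$ queries of block $j$, with $|\langle u_j,x_t\rangle|\le\rho$ for every query $x_t$ of earlier blocks. The remaining $s$ queries are answered by $r(x)=A\,h_{m,\rho}(\langle u_1,x\rangle,\dots,\langle u_q,x\rangle,0,\dots,0)+q_0(x)$; then $\widehat x$ is determined by the algorithm. Next a unit vector $u_{q+1}$ is chosen orthogonal to $u_1,\dots,u_q$, to $x_{qb+1},\dots,x_T$ and to $\widehat x$, with $|\langle u_{q+1},x_t\rangle|\le\rho$ for $t\le qb$. Finally, for $k=q+2,\dots,m$ unit vectors $u_k$ orthogonal to $u_1,\dots,u_{k-1}$ are chosen with $|\langle u_k,x_t\rangle|\le\rho$ for $t=1,\dots,T$ and $|\langle u_k,\widehat x\rangle|\le\rho$. (All these choices are possible when $d$ is large enough and $m^3\log(ed)\le c_0d$ for a small universal constant $c_0>0$; this is the standing assumption of the construction.) With $U=(u_1,\dots,u_m)\in\mathbb R^{d\times m}$ define $$F_U(x):=A\,h_{m,\rho}(U^\top x)+\frac{\beta_0}{8}\operatorname{dist}(x,B_2^d(R_0))^2+\frac\eta2\|x\|_2^2 .$$ *)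

theory Defs
  imports "HOL-Analysis.Analysis"
begin

text \<open>
  Vectors indexed by \<open>{1..m}\<close>, with \<open>m\<close> a term, are functions on \<^typ>\<open>nat\<close> of which only the
  values on \<open>{1..m}\<close> matter; the points of \<open>\<real>\<^sup>m\<close> are the elements of \<open>{1..m} \<rightarrow>\<^sub>E UNIV\<close>.
  Likewise a frame \<open>U \<in> \<real>\<^bsup>d\<times>m\<^esup>\<close> is given by its columns \<open>u 1, \<dots>, u m\<close>, so that
  \<open>U\<^sup>T x\<close> is \<open>\<lambda>i. u i \<bullet> x\<close>. The ambient space is \<open>real ^ 'n\<close> with \<open>d = CARD('n)\<close>.
\<close>

definition g_max :: "nat \<Rightarrow> real \<Rightarrow> (nat \<Rightarrow> real) \<Rightarrow> real" where
  "g_max m \<rho> y = Max ((\<lambda>i. y i - 8 * \<rho> * real i) ` {1..m})"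

definition h_env :: "nat \<Rightarrow> real \<Rightarrow> (nat \<Rightarrow> real) \<Rightarrow> real" where
  "h_env m \<rho> y =
     (INF z\<in>{1..m} \<rightarrow>\<^sub>E UNIV. g_max m \<rho> z + 1 / \<rho> * (\<Sum>i=1..m. (z i - y i)\<^sup>2))"

definition rad0 :: "real \<Rightarrow> real" where
  "rad0 R = R / 4"

definition rho :: "real \<Rightarrow> nat \<Rightarrow> real" where
  "rho R m = rad0 R / (64 * real m powr (3 / 2))"

definition amp :: "real \<Rightarrow> real \<Rightarrow> nat \<Rightarrow> real" where
  "amp R \<beta>\<^sub>0 m = \<beta>\<^sub>0 * rho R m / 8"

definition eta :: "real \<Rightarrow> nat \<Rightarrow> real" where
  "eta \<beta>\<^sub>0 m = \<beta>\<^sub>0 / (4096 * (real m)\<^sup>2)"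

definition q_zero :: "real \<Rightarrow> real \<Rightarrow> nat \<Rightarrow> real ^ 'n \<Rightarrow> real" where
  "q_zero R \<beta>\<^sub>0 m x =
     \<beta>\<^sub>0 / 8 * (infdist x (cball 0 (rad0 R)))\<^sup>2 + eta \<beta>\<^sub>0 m / 2 * (norm x)\<^sup>2"

definition F_obj :: "real \<Rightarrow> real \<Rightarrow> nat \<Rightarrow> (nat \<Rightarrow> real ^ 'n) \<Rightarrow> real ^ 'n \<Rightarrow> real" where
  "F_obj R \<beta>\<^sub>0 m u x =
     amp R \<beta>\<^sub>0 m * h_env m (rho R m) (\<lambda>i. u i \<bullet> x)
     + \<beta>\<^sub>0 / 8 * (infdist x (cball 0 (rad0 R)))\<^sup>2 + eta \<beta>\<^sub>0 m / 2 * (norm x)\<^sup>2"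

text \<open>The answer to \<open>x\<close> while only \<open>u 1, \<dots>, u k\<close> have been chosen.\<close>

definition partial_response ::
    "real \<Rightarrow> real \<Rightarrow> nat \<Rightarrow> (nat \<Rightarrow> real ^ 'n) \<Rightarrow> nat \<Rightarrow> real ^ 'n \<Rightarrow> real" where
  "partial_response R \<beta>\<^sub>0 m u k x =
     amp R \<beta>\<^sub>0 m * h_env m (rho R m) (\<lambda>i. if i \<le> k then u i \<bullet> x else 0) + q_zero R \<beta>\<^sub>0 m x"

text \<open>
  A history of \<open>n\<close> query/response pairs is an element of \<open>{1..n} \<rightarrow>\<^sub>E X \<times> UNIV\<close>, with
  \<open>X = cball 0 R\<close>. The map \<open>Q t\<close> gives the \<open>t\<close>-th query from the history of the first
  \<open>t - 1\<close> pairs, and \<open>out\<close> gives the output from all \<open>T\<close> pairs.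
\<close>

definition history_space :: "real \<Rightarrow> nat set \<Rightarrow> (nat \<Rightarrow> (real ^ 'n) \<times> real) measure" where
  "history_space R I = (\<Pi>\<^sub>M s\<in>I. restrict_space borel (cball 0 R) \<Otimes>\<^sub>M borel)"

definition adaptive_algorithm ::
    "real \<Rightarrow> nat \<Rightarrow> (nat \<Rightarrow> (nat \<Rightarrow> (real ^ 'n) \<times> real) \<Rightarrow> real ^ 'n)
      \<Rightarrow> ((nat \<Rightarrow> (real ^ 'n) \<times> real) \<Rightarrow> real ^ 'n) \<Rightarrow> bool" where
  "adaptive_algorithm R T Q out \<longleftrightarrow>
     (\<forall>t\<in>{1..T}. Q t \<in> history_space R {1..<t} \<rightarrow>\<^sub>M restrict_space borel (cball 0 R)) \<and>
     out \<in> history_space R {1..T} \<rightarrow>\<^sub>M restrict_space borel (cball 0 R)"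

text \<open>
  The history after \<open>t\<close> calls when the algorithm interacts with a fixed objective \<open>f\<close>;
  the constant \<^term>\<open>undefined\<close> function is the unique (empty) history of length 0.
\<close>

primrec interaction ::
    "(nat \<Rightarrow> (nat \<Rightarrow> 'a \<times> real) \<Rightarrow> 'a) \<Rightarrow> ('a \<Rightarrow> real) \<Rightarrow> nat \<Rightarrow> nat \<Rightarrow> 'a \<times> real" where
  "interaction Q f 0 = (\<lambda>_. undefined)"
| "interaction Q f (Suc t) =
     (let x = Q (Suc t) (interaction Q f t) in (interaction Q f t)(Suc t := (x, f x)))"

definition interaction_query ::
    "(nat \<Rightarrow> (nat \<Rightarrow> 'a \<times> real) \<Rightarrow> 'a) \<Rightarrow> ('a \<Rightarrow> real) \<Rightarrow> nat \<Rightarrow> 'a" where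
  "interaction_query Q f t = Q t (interaction Q f (t - 1))"

definition interaction_output ::
    "nat \<Rightarrow> (nat \<Rightarrow> (nat \<Rightarrow> 'a \<times> real) \<Rightarrow> 'a) \<Rightarrow> ((nat \<Rightarrow> 'a \<times> real) \<Rightarrow> 'a)
      \<Rightarrow> ('a \<Rightarrow> real) \<Rightarrow> 'a" where
  "interaction_output T Q out f = out (interaction Q f T)"

text \<open>
  The data \<open>x, r, xhat, u\<close> form a completed run of the batched delayed-rotation construction.
  The choices of the \<open>u j\<close> are free subject to the listed constraints, and each constraint and
  each response involves only data already available at its stage, so the completed runs are
  exactly the tuples satisfying all of them.
\<close>

definition completed_run ::
    "real \<Rightarrow> real \<Rightarrow> nat \<Rightarrow> nat \<Rightarrow> (nat \<Rightarrow> (nat \<Rightarrow> (real ^ 'n) \<times> real) \<Rightarrow> real ^ 'n)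
      \<Rightarrow> ((nat \<Rightarrow> (real ^ 'n) \<times> real) \<Rightarrow> real ^ 'n)
      \<Rightarrow> (nat \<Rightarrow> real ^ 'n) \<Rightarrow> (nat \<Rightarrow> real) \<Rightarrow> real ^ 'n \<Rightarrow> (nat \<Rightarrow> real ^ 'n) \<Rightarrow> bool" where
  "completed_run R \<beta>\<^sub>0 m T Q out x r xhat u \<longleftrightarrow>
     (let b = CARD('n) div 4; q = T div b; \<rho> = rho R m in
       \<comment> \<open>the algorithm\<close>
       (\<forall>t\<in>{1..T}. x t = Q t (\<lambda>s\<in>{1..<t}. (x s, r s))) \<and>
       xhat = out (\<lambda>s\<in>{1..T}. (x s, r s)) \<and>
       \<comment> \<open>the responses\<close>
       (\<forall>j\<in>{1..q}. \<forall>t\<in>{(j - 1) * b + 1..j * b}.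
          r t = partial_response R \<beta>\<^sub>0 m u (j - 1) (x t)) \<and>
       (\<forall>t\<in>{q * b + 1..T}. r t = partial_response R \<beta>\<^sub>0 m u q (x t)) \<and>
       \<comment> \<open>the frame\<close>
       (\<forall>j\<in>{1..m}. norm (u j) = 1 \<and> (\<forall>i\<in>{1..<j}. u j \<bullet> u i = 0)) \<and>
       (\<forall>j\<in>{1..q}.
          (\<forall>t\<in>{(j - 1) * b + 1..j * b}. u j \<bullet> x t = 0) \<and>
          (\<forall>t\<in>{1..(j - 1) * b}. \<bar>u j \<bullet> x t\<bar> \<le> \<rho>)) \<and>
       (\<forall>t\<in>{q * b + 1..T}. u (q + 1) \<bullet> x t = 0) \<and>
       u (q + 1) \<bullet> xhat = 0 \<and>
       (\<forall>t\<in>{1..q * b}. \<bar>u (q + 1) \<bullet> x t\<bar> \<le> \<rho>) \<and>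
       (\<forall>k\<in>{q + 2..m}.
          (\<forall>t\<in>{1..T}. \<bar>u k \<bullet> x t\<bar> \<le> \<rho>) \<and> \<bar>u k \<bullet> xhat\<bar> \<le> \<rho>))"

end

theory Submission
  imports Defs
begin

text \<open>
  The minimiser \<open>z\<close> of the envelope at \<open>y\<close> satisfies \<open>\<parallel>z - y\<parallel> \<le> \<rho> / 2\<close>. If \<open>y j = 0\<close> and
  \<open>\<bar>y i\<bar> \<le> \<rho>\<close> for \<open>i > j\<close>, then the offsets \<open>8 * \<rho> * i\<close> prevent every index beyond \<open>j\<close> from
  attaining the maximum near \<open>z\<close>, so the envelope does not see the coordinates beyond \<open>j\<close>.
  The vectors chosen after a query has been answered only enter through such coordinates, the
  first of them being orthogonal to the query. Hence the answer is already the value of the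
  final objective, and the interaction with that objective reproduces the run.
\<close>

lemma g_max_ge: "z i - 8 * \<rho> * real i \<le> g_max m \<rho> z" if "i \<in> {1..m}"
  unfolding g_max_def using that by (intro Max_ge) auto

lemma g_max_le:
  assumes "1 \<le> m" and "\<And>i. i \<in> {1..m} \<Longrightarrow> z i - 8 * \<rho> * real i \<le> c"
  shows "g_max m \<rho> z \<le> c"
  unfolding g_max_def using assms by (subst Max_le_iff) auto

text \<open>A real infimum is informative only for a set bounded below. Coordinate 1 alone gives the
  bound, since \<open>s + s\<^sup>2 / \<rho>\<close> is at least
  \<open>- \<rho> / 4\<close>.\<close>

lemma bdd_below_h_env:
  assumes "\<rho> > 0" and "1 \<le> m"
  shows "bdd_below ((\<lambda>z. g_max m \<rho> z + 1 / \<rho> * (\<Sum>i=1..m. (z i - y i)\<^sup>2)) ` S)"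
proof (rule bdd_belowI2)
  fix z
  have "z 1 - 8 * \<rho> \<le> g_max m \<rho> z"
    using g_max_ge[of 1 m z \<rho>] assms by simp
  moreover have "(z 1 - y 1)\<^sup>2 \<le> (\<Sum>i=1..m. (z i - y i)\<^sup>2)"
    using assms by (intro member_le_sum) auto
  then have "1 / \<rho> * (z 1 - y 1)\<^sup>2 \<le> 1 / \<rho> * (\<Sum>i=1..m. (z i - y i)\<^sup>2)"
    using assms by (intro mult_left_mono) auto
  moreover have "1 / \<rho> * (z 1 - y 1)\<^sup>2 + (z 1 - y 1) + \<rho> / 4 = (z 1 - y 1 + \<rho> / 2)\<^sup>2 / \<rho>"
    using assms by (simp add: field_simps power2_eq_square)
  moreover have "(z 1 - y 1 + \<rho> / 2)\<^sup>2 / \<rho> \<ge> 0"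
    using assms by simp
  ultimately show "y 1 - 8 * \<rho> - \<rho> / 4 \<le> g_max m \<rho> z + 1 / \<rho> * (\<Sum>i=1..m. (z i - y i)\<^sup>2)"
    by linarith
qed

text \<open>No minimiser has to exist: every competitor \<open>z\<close> for \<open>y\<close> is
  turned into a competitor \<open>z'\<close> for \<open>y'\<close> of no larger cost. The hypotheses
  fit a truncated and a full vector in either order, so two applications give equality.\<close>

lemma h_env_le:
  assumes "\<rho> > 0" and j: "j \<in> {1..m}"
    and eq: "\<And>i. i \<in> {1..j} \<Longrightarrow> y' i = y i" and "y j = 0"
    and small: "\<And>i. i \<in> {j<..m} \<Longrightarrow> y' i \<le> \<rho>"
  shows "h_env m \<rho> y' \<le> h_env m \<rho> y"
  unfolding h_env_def[of m \<rho> y]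
proof (rule cINF_greatest)
  show "{1..m} \<rightarrow>\<^sub>E (UNIV :: real set) \<noteq> {}"
    by (simp add: PiE_eq_empty_iff)
next
  fix z :: "nat \<Rightarrow> real"
  assume z: "z \<in> {1..m} \<rightarrow>\<^sub>E UNIV"
  txt \<open>Raising \<open>z j\<close> to \<open>- 7 * \<rho>\<close> lowers the quadratic term at least as much as it raises \<open>g_max\<close>,
    and makes room for replacing the coordinates beyond \<open>j\<close> by those of \<open>y'\<close>.\<close>
  define a where "a = max (z j) (- 7 * \<rho>) - z j"
  define z' where "z' = (\<lambda>i. if i \<in> {j<..m} then y' i else if i = j then z j + a else z i)"
  have m: "1 \<le> m" and a: "a \<ge> 0" and zj: "z j + a \<ge> - 7 * \<rho>"
    using j by (auto simp: a_def)
  have "a = 0 \<or> z j + a = - 7 * \<rho>"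
    by (auto simp: a_def)
  \<comment> \<open>In the lifted case the factor \<open>a - 2 * (z j + a)\<close> equals
    \<open>a + 14 * \<rho>\<close>. Divided by \<open>\<rho>\<close>, the gain pays for an increase
    of \<open>g_max\<close> by \<open>a\<close>.\<close>
  then have gain: "(z j)\<^sup>2 - (z j + a)\<^sup>2 \<ge> \<rho> * a"
  proof
    assume *: "z j + a = - 7 * \<rho>"
    have "(z j)\<^sup>2 - (z j + a)\<^sup>2 = a * (a - 2 * (z j + a))"
      by (simp add: power2_eq_square algebra_simps)
    also have "\<dots> \<ge> a * \<rho>"
      using * a assms(1) by (intro mult_left_mono) auto
    finally show ?thesis by (simp add: mult.commute)
  qed simp
  have z': "z' \<in> {1..m} \<rightarrow>\<^sub>E UNIV"
    using z j by (auto simp: z'_def PiE_iff extensional_def)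
  have "g_max m \<rho> z' \<le> g_max m \<rho> z + a"
  proof (rule g_max_le[OF m])
    fix i assume i: "i \<in> {1..m}"
    have gj: "z j - 8 * \<rho> * real j \<le> g_max m \<rho> z"
      using j by (rule g_max_ge)
    show "z' i - 8 * \<rho> * real i \<le> g_max m \<rho> z + a"
    proof (cases "i > j")
      case True
      \<comment> \<open>The level \<open>- 7 * \<rho>\<close> comes from here: a value up to
        \<open>\<rho>\<close> at an index beyond \<open>j\<close> loses at least
        \<open>8 * \<rho>\<close> against index \<open>j\<close>.\<close>
      then have "8 * \<rho> * (real j + 1) \<le> 8 * \<rho> * real i"
        using assms(1) by (intro mult_left_mono) auto
      moreover have "y' i \<le> \<rho>" using small True i by auto
      ultimately show ?thesis
        using True i gj zj by (simp add: z'_def algebra_simps)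
    next
      case False
      then show ?thesis
        using g_max_ge[OF i, of z \<rho>] a by (auto simp: z'_def)
    qed
  qed
  moreover have "(\<Sum>i=1..m. (z' i - y' i)\<^sup>2) + \<rho> * a \<le> (\<Sum>i=1..m. (z i - y i)\<^sup>2)"
  proof -
    \<comment> \<open>Below \<open>j\<close> the terms agree; beyond \<open>j\<close> those on the
      left vanish.\<close>
    have "(\<Sum>i\<in>{1..m}-{j}. (z' i - y' i)\<^sup>2) \<le> (\<Sum>i\<in>{1..m}-{j}. (z i - y i)\<^sup>2)"
      using eq by (intro sum_mono) (auto simp: z'_def)
    moreover have "(z' j - y' j)\<^sup>2 + \<rho> * a \<le> (z j - y j)\<^sup>2"
      using gain eq[of j] \<open>y j = 0\<close> j by (simp add: z'_def)
    ultimately show ?thesis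
      using j sum.remove[of "{1..m}" j "\<lambda>i. (z' i - y' i)\<^sup>2"]
        sum.remove[of "{1..m}" j "\<lambda>i. (z i - y i)\<^sup>2"] by simp
  qed
  then have "1 / \<rho> * ((\<Sum>i=1..m. (z' i - y' i)\<^sup>2) + \<rho> * a) \<le> 1 / \<rho> * (\<Sum>i=1..m. (z i - y i)\<^sup>2)"
    using assms(1) by (intro mult_left_mono) auto
  moreover have "h_env m \<rho> y' \<le> g_max m \<rho> z' + 1 / \<rho> * (\<Sum>i=1..m. (z' i - y' i)\<^sup>2)"
    unfolding h_env_def using bdd_below_h_env[OF assms(1) m] z' by (rule cINF_lower)
  ultimately show "h_env m \<rho> y' \<le> g_max m \<rho> z + 1 / \<rho> * (\<Sum>i=1..m. (z i - y i)\<^sup>2)"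
    using assms(1) by (simp add: distrib_left)
qed

lemma rho_pos: "rho R m > 0" if "R > 0" and "1 \<le> m"
  using that by (simp add: rho_def rad0_def)

text \<open>Index \<open>Suc k\<close> is the first hidden one. Truncated and full vector both
  vanish there, so it serves as \<open>j\<close> in \<open>h_env_le\<close> for both
  inequalities.\<close>

lemma partial_response_eq_F_obj:
  assumes "R > 0" and "k < m" and "u (Suc k) \<bullet> x = 0"
    and "\<And>i. i \<in> {Suc k<..m} \<Longrightarrow> \<bar>u i \<bullet> x\<bar> \<le> rho R m"
  shows "partial_response R \<beta>\<^sub>0 m u k x = F_obj R \<beta>\<^sub>0 m u x"
proof -
  have \<rho>: "rho R m > 0" using assms by (intro rho_pos) auto
  have eq: "(if i \<le> k then u i \<bullet> x else 0) = u i \<bullet> x" if "i \<in> {1..Suc k}" for i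
    using that assms(3) by (cases "i = Suc k") auto
  have "h_env m (rho R m) (\<lambda>i. if i \<le> k then u i \<bullet> x else 0) = h_env m (rho R m) (\<lambda>i. u i \<bullet> x)"
  proof (rule antisym)
    show "h_env m (rho R m) (\<lambda>i. if i \<le> k then u i \<bullet> x else 0) \<le> h_env m (rho R m) (\<lambda>i. u i \<bullet> x)"
      by (rule h_env_le[where j = "Suc k"]) (use \<rho> assms eq in auto)
    show "h_env m (rho R m) (\<lambda>i. u i \<bullet> x) \<le> h_env m (rho R m) (\<lambda>i. if i \<le> k then u i \<bullet> x else 0)"
    proof (rule h_env_le[where j = "Suc k"])
      show "u i \<bullet> x \<le> rho R m" if "i \<in> {Suc k<..m}" for i
        using assms(4)[OF that] by linarith
    qed (use \<rho> assms eq in auto)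
  qed
  then show ?thesis
    by (simp add: partial_response_def F_obj_def q_zero_def)
qed

text \<open>The number of complete blocks before a query counts the vectors used in its answer; it
  is the \<open>k\<close> of \<open>partial_response_eq_F_obj\<close>, and equals \<open>q\<close>
  for the remaining queries.\<close>

lemma completed_run_response:
  fixes u :: "nat \<Rightarrow> real ^ 'n"
  assumes "R > 0" and b: "CARD('n) div 4 > 0" and T: "T < (CARD('n) div 4) * m"
    and run: "completed_run R \<beta>\<^sub>0 m T Q out x r xhat u" and t: "t \<in> {1..T}"
  shows "r t = F_obj R \<beta>\<^sub>0 m u (x t)"
proof -
  define b where "b = CARD('n) div 4"
  define q where "q = T div b"
  have "b > 0" using b by (simp add: b_def)
  \<comment> \<open>This keeps index \<open>q + 1\<close>, the first hidden one for the remaining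
    queries, inside the frame.\<close>
  have "q < m"
    using T by (simp add: q_def b_def less_mult_imp_div_less mult.commute)
  note run' = run[unfolded completed_run_def Let_def, folded b_def, folded q_def]
  have late: "\<bar>u i \<bullet> x t\<bar> \<le> rho R m" if "i \<in> {q + 2..m}" for i
    using run' that t by blast
  show ?thesis
  proof (cases "t \<le> q * b")
    case True
    \<comment> \<open>Queries are numbered from 1, hence \<open>t - 1\<close>; the block of
      \<open>t\<close> is \<open>Suc k\<close>.\<close>
    define k where "k = (t - 1) div b"
    have "k * b \<le> t - 1" and "t - 1 < Suc k * b"
      using dividend_less_div_times[OF \<open>b > 0\<close>, of "t - 1"]
      by (simp_all add: k_def add.commute)
    then have block: "t \<in> {(Suc k - 1) * b + 1..Suc k * b}"
      using t by auto
    have "k * b < t" using block by simp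
    also have "t \<le> q * b" by (rule True)
    finally have "k * b < q * b" .
    then have "Suc k \<in> {1..q}" by simp
    have "r t = partial_response R \<beta>\<^sub>0 m u (Suc k - 1) (x t)" and "u (Suc k) \<bullet> x t = 0"
      using run' \<open>Suc k \<in> {1..q}\<close> block by blast+
    moreover have "\<bar>u i \<bullet> x t\<bar> \<le> rho R m" if i: "i \<in> {Suc k<..m}" for i
    proof -
      \<comment> \<open>The bound on later vectors is imposed at three stages: at the end of a later
        complete block, for \<open>u (q + 1)\<close>, and for the final vectors.\<close>
      consider "i \<in> {1..q}" | "i = q + 1" | "i \<in> {q + 2..m}" using i by force
      then show ?thesis
      proof cases
        case 1
        have "Suc k * b \<le> (i - 1) * b" using i by (intro mult_le_mono1) auto
        then have "t \<in> {1..(i - 1) * b}" using block t by auto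
        then show ?thesis using run' 1 by blast
      next
        case 2
        have "t \<in> {1..q * b}" using True t by auto
        then show ?thesis using run' 2 by blast
      next
        case 3
        then show ?thesis by (rule late)
      qed
    qed
    ultimately show ?thesis
      using partial_response_eq_F_obj[of R k m u "x t" \<beta>\<^sub>0] \<open>R > 0\<close> \<open>q < m\<close> \<open>Suc k \<in> {1..q}\<close>
      by simp
  next
    case False
    then have "t \<in> {q * b + 1..T}" using t by auto
    then have "r t = partial_response R \<beta>\<^sub>0 m u q (x t)" and "u (q + 1) \<bullet> x t = 0"
      using run' by blast+
    then show ?thesis
      using partial_response_eq_F_obj[of R q m u "x t" \<beta>\<^sub>0] \<open>R > 0\<close> \<open>q < m\<close> late by simp
  qed
qed

text \<open>A deterministic algorithm repeats its query on an equal history, so induction applies.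
  Histories agree as total functions: both sides are \<open>undefined\<close> outside
  \<open>{1..n}\<close>.\<close>

lemma interaction_eq_restrict:
  assumes "\<And>t. t \<in> {1..T} \<Longrightarrow> x t = Q t (\<lambda>s\<in>{1..<t}. (x s, r s))"
    and "\<And>t. t \<in> {1..T} \<Longrightarrow> r t = f (x t)" and "n \<le> T"
  shows "interaction Q f n = (\<lambda>s\<in>{1..n}. (x s, r s))"
  using assms(3)
proof (induction n)
  case 0
  then show ?case by (simp add: restrict_def)
next
  case (Suc n)
  have "Q (Suc n) (\<lambda>s\<in>{1..n}. (x s, r s)) = x (Suc n)"
    using assms(1)[of "Suc n"] Suc.prems by (simp add: atLeastLessThanSuc_atLeastAtMost)
  moreover have "f (x (Suc n)) = r (Suc n)"
    using assms(2) Suc.prems by simp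
  moreover have "interaction Q f n = (\<lambda>s\<in>{1..n}. (x s, r s))"
    using Suc.prems by (intro Suc.IH) simp
  ultimately have "interaction Q f (Suc n) = (\<lambda>s\<in>{1..n}. (x s, r s))(Suc n := (x (Suc n), r (Suc n)))"
    by (simp add: Let_def)
  also have "\<dots> = (\<lambda>s\<in>{1..Suc n}. (x s, r s))"
    by (auto simp: restrict_def fun_eq_iff)
  finally show ?case .
qed

theorem proposition9p1:
  fixes R \<beta>\<^sub>0 c\<^sub>0 :: real and m T d\<^sub>0 :: nat
    and Q :: "nat \<Rightarrow> (nat \<Rightarrow> (real ^ 'n) \<times> real) \<Rightarrow> real ^ 'n"
    and out :: "(nat \<Rightarrow> (real ^ 'n) \<times> real) \<Rightarrow> real ^ 'n"
    and x :: "nat \<Rightarrow> real ^ 'n" and r :: "nat \<Rightarrow> real" and xhat :: "real ^ 'n"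
    and u :: "nat \<Rightarrow> real ^ 'n"
  assumes "R > 0" and "\<beta>\<^sub>0 > 0"
    and "1 \<le> m" and "real m \<le> real CARD('n) / 4"
    and "T < (CARD('n) div 4) * m"
    and "c\<^sub>0 > 0" and "d\<^sub>0 \<le> CARD('n)"
    and "real m ^ 3 * ln (exp 1 * real CARD('n)) \<le> c\<^sub>0 * real CARD('n)"
    and "adaptive_algorithm R T Q out"
    and "completed_run R \<beta>\<^sub>0 m T Q out x r xhat u"
  shows "(\<forall>t\<in>{1..T}. r t = F_obj R \<beta>\<^sub>0 m u (x t)) \<and>
    (\<forall>t\<in>{1..T}. x t = interaction_query Q (F_obj R \<beta>\<^sub>0 m u) t) \<and>
    xhat = interaction_output T Q out (F_obj R \<beta>\<^sub>0 m u)"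
proof -
  let ?f = "F_obj R \<beta>\<^sub>0 m u"
  have "CARD('n) div 4 > 0"
    using assms(5) by (cases "CARD('n) div 4 = 0") auto
  then have resp: "r t = ?f (x t)" if "t \<in> {1..T}" for t
    using completed_run_response assms(1,5,10) that by blast
  have query: "x t = Q t (\<lambda>s\<in>{1..<t}. (x s, r s))" if "t \<in> {1..T}" for t
    using assms(10) that unfolding completed_run_def Let_def by blast
  have result: "xhat = out (\<lambda>s\<in>{1..T}. (x s, r s))"
    using assms(10) unfolding completed_run_def Let_def by blast
  have inter: "interaction Q ?f n = (\<lambda>s\<in>{1..n}. (x s, r s))" if "n \<le> T" for n
    using query resp that by (rule interaction_eq_restrict)
  have "x t = interaction_query Q ?f t" if t: "t \<in> {1..T}" for t
  proof -
    have "{1..t - 1} = {1..<t}" and "t - 1 \<le> T" using t by auto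
    then show ?thesis
      using query[OF t] inter[of "t - 1"] t by (simp add: interaction_query_def)
  qed
  moreover have "xhat = interaction_output T Q out ?f"
    using result inter[of T] by (simp add: interaction_output_def)
  ultimately show ?thesis
    using resp by blast
qed

end
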